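(* Let $R=Q/P$ be a nonconstant rational function with $P,Q\in\mathbb{C}[z]$ coprime, and let $z_0\in\mathbb{C}$ be a pole of $R$ of order $s\ge1$. Then the tangent rays at $z_0$ of the inflection curve $\mathfrak{I}_R$ coincide with the union of the incoming and outgoing separatrix directions at $z_0$ of the vector field $-R(z)\frac{\partial}{\partial z}$.
   Context: The affine inflection curve $\mathfrak{I}_R$ is the closure in $\mathbb{C}$ of $\{z\in\mathbb{C}: R(z)\neq0,\ P(z)\neq0,\ \operatorname{Im}R'(z)=0\}$; equivalently it is the zero set in $\mathbb{C}$ of $F_R=\frac{1}{2i}\bigl(W\overline{P}^{\,2}-\overline{W}P^2\bigr)$ with $W=Q'P-QP'$. Its tangent rays at $z_0$ are the rays from $z_0$ tangent to the local branches of $\mathfrak{I}_R$ at $z_0$. Trajectories of $-R(z)\frac{\partial}{\partial z}$ are the solutions of $\dot z=-R(z)$ in real time. If $R(z)=\frac{a}{(z-z_0)^s}+O((z-z_0)^{-s+1})$ with $a\ne0$, the vector field $-R\,\partial_z$ has $s+1$ incoming and $s+1$ outgoing separatrix directions at $z_0$, alternating around $z_0$: they are the rays along which trajectories reach (incoming) or leave (outgoing) the pole in finite time, and they are obtained by solving the leading equation $\dot w=-a\,w^{-s}$, $w=z-z_0$, i.e. they are the directions of the trajectories of the leading equation that tend to $w=0$ in finite forward (incoming) or backward (outgoing) time. *)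

theory Defs
  imports
    "HOL-Complex_Analysis.Complex_Analysis"
    "HOL-Computational_Algebra.Computational_Algebra"
    "HOL-Library.Landau_Symbols"
begin

definition rational_fun :: "complex poly \<Rightarrow> complex poly \<Rightarrow> complex \<Rightarrow> complex" where
  "rational_fun Q P = (\<lambda>z. poly Q z / poly P z)"

definition inflection_curve :: "complex poly \<Rightarrow> complex poly \<Rightarrow> complex set" where
  "inflection_curve Q P =
     closure {z. rational_fun Q P z \<noteq> 0 \<and> poly P z \<noteq> 0 \<and> Im (deriv (rational_fun Q P) z) = 0}"

definition ray_from :: "complex \<Rightarrow> complex \<Rightarrow> complex set" where
  "ray_from z0 u = {z0 + t *\<^sub>R u | t. t \<ge> 0}"

text \<open>
  A local branch of a plane curve \<open>S\<close> at \<open>z0\<close> is given by an injective real-analytic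
  parametrization \<open>\<gamma>\<close> on an interval around \<open>0\<close> with \<open>\<gamma> 0 = z0\<close>. A complex-valued function of
  a real variable is real-analytic at \<open>0\<close> iff it is, near \<open>0\<close>, the restriction of a holomorphic
  function. The last condition says that apart from \<open>z0\<close>, where several branches may meet,
  the curve \<open>S\<close> is locally nothing but this arc; in particular a set with interior
  near \<open>z0\<close> is not foliated into spurious ``branches''.
\<close>

definition local_branch :: "complex set \<Rightarrow> complex \<Rightarrow> real \<Rightarrow> (real \<Rightarrow> complex) \<Rightarrow> bool" where
  "local_branch S z0 e \<gamma> \<longleftrightarrow>
     e > 0 \<and>
     (\<exists>g. g holomorphic_on ball 0 e \<and> (\<forall>t\<in>{-e<..<e}. \<gamma> t = g (of_real t))) \<and>
     inj_on \<gamma> {-e<..<e} \<and>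
     \<gamma> 0 = z0 \<and>
     \<gamma> ` {-e<..<e} \<subseteq> S \<and>
     openin (top_of_set S) (\<gamma> ` ({-e<..<e} - {0}))"

text \<open>
  Each branch has two halves at \<open>z0\<close>, \<open>t > 0\<close> and \<open>t < 0\<close>; the tangent ray of a half is
  the limit of its secant rays (\<open>sgn w = w / \<bar>w\<bar>\<close>), which makes sense also if \<open>\<gamma>' 0 = 0\<close>.
\<close>

definition tangent_rays :: "complex set \<Rightarrow> complex \<Rightarrow> complex set set" where
  "tangent_rays S z0 = {ray_from z0 u | u. \<exists>e \<gamma>. local_branch S z0 e \<gamma> \<and>
     (((\<lambda>t. sgn (\<gamma> t - z0)) \<longlongrightarrow> u) (at_right 0) \<or>
      ((\<lambda>t. sgn (\<gamma> t - z0)) \<longlongrightarrow> u) (at_left 0))}"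

definition leading_term_at_pole ::
    "(complex \<Rightarrow> complex) \<Rightarrow> complex \<Rightarrow> nat \<Rightarrow> complex \<Rightarrow> bool" where
  "leading_term_at_pole R z0 s a \<longleftrightarrow> s \<ge> 1 \<and> a \<noteq> 0 \<and>
     (\<lambda>z. R z - a / (z - z0) ^ s) \<in> O[at z0](\<lambda>z. (z - z0) powi (1 - int s))"

definition leading_trajectory ::
    "nat \<Rightarrow> complex \<Rightarrow> real \<Rightarrow> real \<Rightarrow> (real \<Rightarrow> complex) \<Rightarrow> bool" where
  "leading_trajectory s a t0 t1 w \<longleftrightarrow> t0 < t1 \<and>
     (\<forall>t\<in>{t0<..<t1}. w t \<noteq> 0 \<and> (w has_vector_derivative (- (a / w t ^ s))) (at t))"

text \<open>
  Separatrix directions of the vector field \<open>- R(z) \<partial>/\<partial>z\<close> at a pole \<open>z0\<close> of \<open>R\<close>. Note the sign: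
  the argument is \<open>R\<close>, the field is \<open>- R\<close>. The pair \<open>(s, a)\<close> is uniquely determined by \<open>R\<close>
  and \<open>z0\<close>.
\<close>

definition incoming_separatrix_rays ::
    "(complex \<Rightarrow> complex) \<Rightarrow> complex \<Rightarrow> complex set set" where
  "incoming_separatrix_rays R z0 = {ray_from z0 u | u. \<exists>s a t0 t1 w.
     leading_term_at_pole R z0 s a \<and> leading_trajectory s a t0 t1 w \<and>
     (w \<longlongrightarrow> 0) (at_left t1) \<and> ((\<lambda>t. sgn (w t)) \<longlongrightarrow> u) (at_left t1)}"

definition outgoing_separatrix_rays ::
    "(complex \<Rightarrow> complex) \<Rightarrow> complex \<Rightarrow> complex set set" where
  "outgoing_separatrix_rays R z0 = {ray_from z0 u | u. \<exists>s a t0 t1 w.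
     leading_term_at_pole R z0 s a \<and> leading_trajectory s a t0 t1 w \<and>
     (w \<longlongrightarrow> 0) (at_right t0) \<and> ((\<lambda>t. sgn (w t)) \<longlongrightarrow> u) (at_right t0)}"

end

theory Submission
  imports Defs
begin

text \<open>
  Write \<open>R = f / (z - z0)^s\<close> near \<open>z0\<close> with \<open>f\<close> holomorphic and \<open>a = f z0 \<noteq> 0\<close>. Both sides are
  the set of rays in the directions \<open>u\<close> with \<open>u^(s+1) = \<plusminus> sgn a\<close>.

  Along a solution of \<open>w' = - a / w^s\<close> the function \<open>w^(s+1)\<close> is affine in \<open>t\<close> with slope
  \<open>- (s+1) a\<close>, so the incoming directions are those with \<open>u^(s+1) = sgn a\<close>; reversing time
  replaces \<open>a\<close> by \<open>- a\<close> and gives the outgoing ones.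

  On the other side, \<open>R' = h / (z - z0)^(s+1)\<close> with \<open>h z0 = - s a\<close>. A holomorphic \<open>(s+1)\<close>-st root
  of \<open>h\<close> yields a local coordinate \<open>\<phi>\<close> with \<open>R' = \<phi>^-(s+1)\<close>, in which the inflection curve is the
  union of the \<open>s + 1\<close> lines where \<open>\<phi>^(s+1)\<close> is real. Pulling these lines back gives branches
  in all the directions claimed, and reality of \<open>R'\<close> along an arbitrary branch shows that there
  are no others.
\<close>

section \<open>Separatrix directions of the leading equation\<close>

lemma sgn_power_complex: "sgn (z ^ n) = sgn z ^ n" for z :: complex
  by (simp add: sgn_eq norm_power power_divide)

lemma leading_trajectory_time_reversal:
  assumes "leading_trajectory s a t0 t1 w"
  shows "leading_trajectory s (- a) (- t1) (- t0) (\<lambda>t. w (- t))"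
  unfolding leading_trajectory_def
proof (intro conjI ballI)
  show "- t1 < - t0" using assms by (simp add: leading_trajectory_def)
  fix t assume t: "t \<in> {- t1<..<- t0}"
  then have *: "w (- t) \<noteq> 0" "(w has_vector_derivative - (a / w (- t) ^ s)) (at (- t))"
    using assms by (auto simp: leading_trajectory_def)
  then show "w (- t) \<noteq> 0" by simp
  have "((w \<circ> uminus) has_vector_derivative (-1) *\<^sub>R (- (a / w (- t) ^ s))) (at t)"
    by (rule vector_diff_chain_at) (use *(2) in \<open>auto intro!: derivative_eq_intros\<close>)
  then show "((\<lambda>t. w (- t)) has_vector_derivative - (- a / w (- t) ^ s)) (at t)"
    by (simp add: o_def)
qed

lemma leading_trajectory_power:
  assumes w: "leading_trajectory s a t0 t1 w" and lim: "(w \<longlongrightarrow> 0) (at_left t1)"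
    and t: "t \<in> {t0<..<t1}"
  shows "w t ^ Suc s = of_real (real (Suc s) * (t1 - t)) * a"
proof -
  \<comment> \<open>\<open>g\<close> is \<open>w ^ Suc s\<close> with its linear drift removed,
    hence a first integral of the leading equation.\<close>
  define g where "g = (\<lambda>t. w t ^ Suc s + of_real (real (Suc s) * t) * a)"
  have "t0 < t1" using w by (simp add: leading_trajectory_def)
  have "(g has_vector_derivative 0) (at x within {t0<..<t1})" if x: "x \<in> {t0<..<t1}" for x
  proof -
    have *: "w x \<noteq> 0" "(w has_vector_derivative - (a / w x ^ s)) (at x)"
      using w x by (auto simp: leading_trajectory_def)
    have "((\<lambda>z. z ^ Suc s) has_field_derivative of_nat (Suc s) * w x ^ s) (at (w x))"
      by (rule DERIV_cong[OF DERIV_power_Suc[OF DERIV_ident]]) simp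
    then have "(((\<lambda>z. z ^ Suc s) \<circ> w) has_vector_derivative
        - (a / w x ^ s) * (of_nat (Suc s) * w x ^ s)) (at x)"
      by (rule field_vector_diff_chain_at[OF *(2)])
    moreover have eq: "- (a / w x ^ s) * (of_nat (Suc s) * w x ^ s) = - (of_nat (Suc s) * a)"
      using *(1) by (simp add: field_simps)
    ultimately have "((\<lambda>x. w x ^ Suc s) has_vector_derivative - (of_nat (Suc s) * a)) (at x)"
      by (simp only: o_def eq)
    moreover have "((\<lambda>x. of_real (real (Suc s) * x) * a) has_vector_derivative of_nat (Suc s) * a) (at x)"
      by (auto intro!: derivative_eq_intros has_vector_derivative_of_real)
    ultimately have "(g has_vector_derivative 0) (at x)"
      unfolding g_def using has_vector_derivative_add by fastforce
    then show ?thesis by (rule has_vector_derivative_at_within)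
  qed
  then obtain c where c: "\<And>x. x \<in> {t0<..<t1} \<Longrightarrow> g x = c"
    using has_vector_derivative_zero_constant[of "{t0<..<t1}" g] by (metis convex_real_interval(8))
  \<comment> \<open>The limit of \<open>w\<close> at the end time fixes the constant of integration
    \<open>c\<close>: the affine function \<open>w ^ Suc s\<close> must vanish at
    \<open>t1\<close>.\<close>
  have "(g \<longlongrightarrow> 0 ^ Suc s + of_real (real (Suc s) * t1) * a) (at_left t1)"
    unfolding g_def by (intro tendsto_intros lim)
  moreover have "eventually (\<lambda>x. g x = c) (at_left t1)"
    using eventually_at_left_real[OF \<open>t0 < t1\<close>] by eventually_elim (rule c)
  ultimately have "((\<lambda>_. c) \<longlongrightarrow> 0 ^ Suc s + of_real (real (Suc s) * t1) * a) (at_left t1)"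
    by (rule Lim_transform_eventually)
  then have "c = of_real (real (Suc s) * t1) * a"
    by (simp add: tendsto_const_iff del: of_nat_Suc of_real_mult)
  with c[OF t] show ?thesis by (simp add: g_def algebra_simps)
qed

text \<open>By the affine formula, \<open>w t ^ Suc s\<close> is a positive multiple of
  \<open>a\<close> before \<open>t1\<close>, so \<open>sgn (w t) ^ Suc s\<close> is constantly
  \<open>sgn a\<close> and the limit inherits this. Conversely, every such \<open>u\<close> carries
  a straight trajectory, which is written down explicitly.\<close>

lemma incoming_leading_direction_iff:
  assumes a: "a \<noteq> 0"
  shows "(\<exists>t0 t1 w. leading_trajectory s a t0 t1 w \<and> (w \<longlongrightarrow> 0) (at_left t1) \<and>
            ((\<lambda>t. sgn (w t)) \<longlongrightarrow> u) (at_left t1)) \<longleftrightarrow> u ^ Suc s = sgn a"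
proof
  assume "\<exists>t0 t1 w. leading_trajectory s a t0 t1 w \<and> (w \<longlongrightarrow> 0) (at_left t1) \<and>
            ((\<lambda>t. sgn (w t)) \<longlongrightarrow> u) (at_left t1)"
  then obtain t0 t1 w where w: "leading_trajectory s a t0 t1 w" "(w \<longlongrightarrow> 0) (at_left t1)"
    "((\<lambda>t. sgn (w t)) \<longlongrightarrow> u) (at_left t1)" by blast
  have "t0 < t1" using w by (simp add: leading_trajectory_def)
  have "((\<lambda>t. sgn (w t) ^ Suc s) \<longlongrightarrow> u ^ Suc s) (at_left t1)"
    by (intro tendsto_intros w)
  moreover have "eventually (\<lambda>t. sgn (w t) ^ Suc s = sgn a) (at_left t1)"
    using eventually_at_left_real[OF \<open>t0 < t1\<close>]
  proof eventually_elim
    case (elim t)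
    have "sgn (w t) ^ Suc s = sgn (of_real (real (Suc s) * (t1 - t)) * a)"
      using leading_trajectory_power[OF w(1,2) elim] by (simp only: sgn_power_complex[symmetric])
    also have "\<dots> = sgn a"
      using elim by (simp add: sgn_mult sgn_of_real del: of_nat_Suc of_real_mult)
    finally show ?case .
  qed
  ultimately have "((\<lambda>_. sgn a) \<longlongrightarrow> u ^ Suc s) (at_left t1)"
    by (rule Lim_transform_eventually)
  then show "u ^ Suc s = sgn a" by (simp add: tendsto_const_iff del: power_Suc)
next
  assume u: "u ^ Suc s = sgn a"
  have "norm u ^ Suc s = norm (sgn a)" by (simp only: norm_power flip: u)
  then have "norm u ^ Suc s = 1" using a by (simp only: norm_sgn) simp
  then have nu: "norm u = 1" using power_eq_imp_eq_base[of "norm u" "Suc s" 1] by simp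
  \<comment> \<open>For a radial solution \<open>r t * u\<close> ending at time 0, norms in the
    affine formula force \<open>r t ^ Suc s = K * (- t)\<close>; \<open>r\<close> is the positive
    root of this.\<close>
  define K where "K = real (Suc s) * norm a"
  define r where "r = (\<lambda>t. (K * (- t)) powr (1 / real (Suc s)))"
  have "K > 0" using a by (simp add: K_def)
  have rpos: "r t > 0" if "t < 0" for t using that \<open>K > 0\<close> by (simp add: r_def mult_pos_neg)
  have rpow: "r t ^ Suc s = K * (- t)" if "t < 0" for t
    using that \<open>K > 0\<close> unfolding r_def
    by (subst powr_realpow[symmetric])  (auto simp: powr_powr mult_pos_neg abs_mult simp del: of_nat_Suc)
  have rder: "(r has_real_derivative - (norm a / r t ^ s)) (at t)" if t: "t < 0" for t
  proof -
    have p: "K * (- t) > 0" using t \<open>K > 0\<close> by (simp add: mult_pos_neg)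
    have "(r has_real_derivative 1 / real (Suc s) * (K * (- t)) powr (1 / real (Suc s) - 1) * (- K)) (at t)"
      unfolding r_def by (rule derivative_eq_intros | use p in simp)+
    also have "(K * (- t)) powr (1 / real (Suc s) - 1) = r t / r t ^ Suc s"
      using p by (subst rpow[OF t]) (simp add: powr_diff r_def)
    also have "\<dots> = 1 / r t ^ s" using rpos[OF t] by simp
    finally show ?thesis by (simp add: K_def del: of_nat_Suc)
  qed
  have "leading_trajectory s a (-1) 0 (\<lambda>t. of_real (r t) * u)"
    unfolding leading_trajectory_def
  proof (intro conjI ballI)
    fix t :: real assume "t \<in> {-1<..<0}"
    then have t: "t < 0" by simp
    show "of_real (r t) * u \<noteq> 0" using rpos[OF t] nu by auto
    \<comment> \<open>Since \<open>a\<close> is a positive multiple of \<open>u ^ Suc s\<close>, the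
      leading field is radial along the ray of \<open>u\<close>, and the complex equation reduces to
      the scalar one in \<open>rder\<close>.\<close>
    have a_eq: "a = of_real (norm a) * u ^ Suc s" using u a by (simp add: sgn_eq)
    have "a / u ^ s = of_real (norm a) * u"
      by (subst a_eq) (use nu in auto)
    moreover have "a / (of_real (r t) * u) ^ s = a / u ^ s / of_real (r t) ^ s"
      by (simp add: power_mult_distrib mult.commute)
    ultimately have "- (a / (of_real (r t) * u) ^ s) = of_real (- (norm a / r t ^ s)) * u"
      by simp
    moreover have "((\<lambda>t. of_real (r t) * u) has_vector_derivative of_real (- (norm a / r t ^ s)) * u) (at t)"
      by (intro has_vector_derivative_mult_left has_vector_derivative_of_real rder[OF t])
    ultimately show "((\<lambda>t. of_real (r t) * u) has_vector_derivative - (a / (of_real (r t) * u) ^ s)) (at t)"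
      by simp
  qed simp
  moreover have "((\<lambda>t. of_real (r t) * u) \<longlongrightarrow> 0) (at_left 0)"
  proof -
    \<comment> \<open>The base tends to 0 here; \<open>tendsto_powr'\<close> still applies because
      the exponent is positive and the base is eventually nonnegative.\<close>
    have "(r \<longlongrightarrow> (K * (- 0)) powr (1 / real (Suc s))) (at_left 0)"
      unfolding r_def
      by (intro tendsto_powr' tendsto_intros)
         (auto simp: eventually_at_left_field mult_nonneg_nonpos \<open>K > 0\<close> less_imp_le intro!: exI[of _ "-1"])
    then have "(r \<longlongrightarrow> 0) (at_left 0)" by simp
    from tendsto_mult[OF tendsto_of_real[OF this] tendsto_const[of u]] show ?thesis by simp
  qed
  moreover have "((\<lambda>t. sgn (of_real (r t) * u)) \<longlongrightarrow> u) (at_left 0)"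
  proof -
    have "eventually (\<lambda>t. sgn (of_real (r t) * u) = u) (at_left (0::real))"
      using eventually_at_left_real[of "-1" "0::real", simplified]
    proof eventually_elim
      case (elim t)
      then show ?case using rpos[of t] nu by (simp add: sgn_mult sgn_of_real) (simp add: sgn_eq)
    qed
    then show ?thesis by (rule tendsto_eventually)
  qed
  ultimately show "\<exists>t0 t1 w. leading_trajectory s a t0 t1 w \<and> (w \<longlongrightarrow> 0) (at_left t1) \<and>
            ((\<lambda>t. sgn (w t)) \<longlongrightarrow> u) (at_left t1)"
    by blast
qed

lemma outgoing_leading_direction_iff:
  assumes a: "a \<noteq> 0"
  shows "(\<exists>t0 t1 w. leading_trajectory s a t0 t1 w \<and> (w \<longlongrightarrow> 0) (at_right t0) \<and>
            ((\<lambda>t. sgn (w t)) \<longlongrightarrow> u) (at_right t0)) \<longleftrightarrow> u ^ Suc s = - sgn a" (is "?L \<longleftrightarrow> _")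
proof -
  have "?L \<longleftrightarrow> (\<exists>t0 t1 w. leading_trajectory s (- a) t0 t1 w \<and> (w \<longlongrightarrow> 0) (at_left t1) \<and>
            ((\<lambda>t. sgn (w t)) \<longlongrightarrow> u) (at_left t1))"
  proof safe
    fix t0 t1 w assume w: "leading_trajectory s a t0 t1 w" "(w \<longlongrightarrow> 0) (at_right t0)"
      "((\<lambda>t. sgn (w t)) \<longlongrightarrow> u) (at_right t0)"
    show "\<exists>t0 t1 w. leading_trajectory s (- a) t0 t1 w \<and> (w \<longlongrightarrow> 0) (at_left t1) \<and>
            ((\<lambda>t. sgn (w t)) \<longlongrightarrow> u) (at_left t1)"
      using leading_trajectory_time_reversal[OF w(1)] w(2,3)
      by (intro exI[of _ "- t1"] exI[of _ "- t0"] exI[of _ "\<lambda>t. w (- t)"])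
         (auto simp: at_left_minus filterlim_filtermap)
  next
    fix t0 t1 w assume w: "leading_trajectory s (- a) t0 t1 w" "(w \<longlongrightarrow> 0) (at_left t1)"
      "((\<lambda>t. sgn (w t)) \<longlongrightarrow> u) (at_left t1)"
    show ?L
      using leading_trajectory_time_reversal[OF w(1)] w(2,3)
      by (intro exI[of _ "- t1"] exI[of _ "- t0"] exI[of _ "\<lambda>t. w (- t)"])
         (auto simp: at_right_minus filterlim_filtermap)
  qed
  then show ?thesis using incoming_leading_direction_iff[of "- a" s u] a by (simp add: sgn_minus)
qed

section \<open>The leading term at a pole and the separatrix rays\<close>

text \<open>If \<open>m\<close> exceeded \<open>n\<close>, the first product would be the second one
  times a positive power of \<open>z - z0\<close> and would tend to 0. Applied in both directions,
  this determines the order of a pole.\<close>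

lemma tendsto_power_mult_imp_order_le:
  fixes R :: "complex \<Rightarrow> complex"
  assumes a: "((\<lambda>z. (z - z0) ^ m * R z) \<longlongrightarrow> a) (at z0)"
    and b: "((\<lambda>z. (z - z0) ^ n * R z) \<longlongrightarrow> b) (at z0)" and "a \<noteq> 0"
  shows "m \<le> n"
proof (rule ccontr)
  assume "\<not> m \<le> n"
  then obtain k where mn: "m = k + n" "k > 0" by (metis add.commute less_imp_add_positive not_le)
  have "((\<lambda>z. (z - z0) ^ k * ((z - z0) ^ n * R z)) \<longlongrightarrow> (z0 - z0) ^ k * b) (at z0)"
    by (intro tendsto_intros b)
  also have "(\<lambda>z. (z - z0) ^ k * ((z - z0) ^ n * R z)) = (\<lambda>z. (z - z0) ^ m * R z)"
    by (simp only: mn(1) power_add mult_ac)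
  finally have "((\<lambda>z. (z - z0) ^ m * R z) \<longlongrightarrow> 0) (at z0)"
    using mn(2) by (simp add: power_0_left)
  with a have "a = 0" using tendsto_unique by (metis at_neq_bot)
  with \<open>a \<noteq> 0\<close> show False by simp
qed

text \<open>The separatrix rays quantify existentially over exponent and coefficient; pinning this
  pair down eliminates the quantifier.\<close>

lemma leading_term_at_pole_iff:
  assumes f: "f field_differentiable at z0" "f z0 \<noteq> 0"
    and R: "\<forall>\<^sub>F z in at z0. R z = f z / (z - z0) ^ s" and s: "s \<ge> 1"
  shows "leading_term_at_pole R z0 s' a \<longleftrightarrow> s' = s \<and> a = f z0"
proof
  have ne: "\<forall>\<^sub>F z in at z0. z \<noteq> z0" by (simp add: eventually_neq_at_within)
  have "(f \<longlongrightarrow> f z0) (at z0)"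
    using field_differentiable_imp_continuous_at[OF f(1)] by (simp add: isCont_def)
  moreover have "\<forall>\<^sub>F z in at z0. f z = (z - z0) ^ s * R z"
    using ne R by eventually_elim auto
  ultimately have lim_f: "((\<lambda>z. (z - z0) ^ s * R z) \<longlongrightarrow> f z0) (at z0)"
    by (rule Lim_transform_eventually)
  {
    assume "leading_term_at_pole R z0 s' a"
    then have s': "s' \<ge> 1" "a \<noteq> 0"
      and O: "(\<lambda>z. R z - a / (z - z0) ^ s') \<in> O[at z0](\<lambda>z. (z - z0) powi (1 - int s'))"
      by (auto simp: leading_term_at_pole_def)
    \<comment> \<open>Multiplication by \<open>(z - z0) ^ s'\<close> turns the error into O(z - z0),
      so \<open>(z - z0) ^ s' * R z\<close> tends to \<open>a\<close>. Comparison with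
      \<open>lim_f\<close> then gives both equalities.\<close>
    have "(\<lambda>z. (z - z0) ^ s' * (R z - a / (z - z0) ^ s')) \<in>
        O[at z0](\<lambda>z. (z - z0) ^ s' * (z - z0) powi (1 - int s'))"
      by (intro landau_o.big.mult O) simp
    also have "O[at z0](\<lambda>z. (z - z0) ^ s' * (z - z0) powi (1 - int s')) = O[at z0](\<lambda>z. z - z0)"
      by (rule landau_o.big.cong, use ne in eventually_elim) (simp add: power_int_diff)
    also have "(\<lambda>z. (z - z0) ^ s' * (R z - a / (z - z0) ^ s')) \<in> O[at z0](\<lambda>z. z - z0) \<longleftrightarrow>
       (\<lambda>z. (z - z0) ^ s' * R z - a) \<in> O[at z0](\<lambda>z. z - z0)"
      by (rule landau_o.big.in_cong, use ne in eventually_elim) (simp add: algebra_simps)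
    finally have O': "(\<lambda>z. (z - z0) ^ s' * R z - a) \<in> O[at z0](\<lambda>z. z - z0)" .
    have "((\<lambda>z. z - z0) \<longlongrightarrow> 0) (at z0)" by (rule tendsto_eq_intros refl | simp)+
    then have "(\<lambda>z. z - z0) \<in> o[at z0](\<lambda>_. 1)" by (intro smalloI_tendsto) auto
    with O' have "(\<lambda>z. (z - z0) ^ s' * R z - a) \<in> o[at z0](\<lambda>_. 1)"
      by (rule landau_o.big_small_trans)
    then have "((\<lambda>z. (z - z0) ^ s' * R z - a) \<longlongrightarrow> 0) (at z0)"
      using smalloD_tendsto by fastforce
    then have lim: "((\<lambda>z. (z - z0) ^ s' * R z) \<longlongrightarrow> a) (at z0)"
      by (simp add: LIM_zero_cancel)
    have "s' = s"
      using tendsto_power_mult_imp_order_le[OF lim lim_f \<open>a \<noteq> 0\<close>]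
        tendsto_power_mult_imp_order_le[OF lim_f lim f(2)] by simp
    with lim lim_f show "s' = s \<and> a = f z0" using tendsto_unique by (metis at_neq_bot)
  }
  {
    assume eq: "s' = s \<and> a = f z0"
    \<comment> \<open>The remainder divided by the comparison function is exactly the difference
      quotient of \<open>f\<close>, and convergence of the quotient yields the O-bound.\<close>
    have "((\<lambda>z. (f z - f z0) / (z - z0)) \<longlongrightarrow> deriv f z0) (at z0)"
      using f(1) by (simp add: DERIV_deriv_iff_field_differentiable flip: has_field_derivative_iff)
    moreover have "\<forall>\<^sub>F z in at z0. (f z - f z0) / (z - z0) =
        (R z - f z0 / (z - z0) ^ s) / (z - z0) powi (1 - int s)"
      using ne R by eventually_elim (simp add: power_int_diff divide_simps)
    ultimately have "((\<lambda>z. (R z - f z0 / (z - z0) ^ s) / (z - z0) powi (1 - int s)) \<longlongrightarrow> deriv f z0) (at z0)"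
      by (rule Lim_transform_eventually)
    moreover have "\<forall>\<^sub>F z in at z0. (z - z0) powi (1 - int s) \<noteq> 0"
      using ne by eventually_elim simp
    ultimately show "leading_term_at_pole R z0 s' a"
      using eq s f(2) unfolding leading_term_at_pole_def by (auto intro: bigoI_tendsto)
  }
qed

lemma separatrix_rays_eq:
  assumes "f field_differentiable at z0" "f z0 \<noteq> 0"
    and "\<forall>\<^sub>F z in at z0. R z = f z / (z - z0) ^ s" and "s \<ge> 1"
  shows "incoming_separatrix_rays R z0 \<union> outgoing_separatrix_rays R z0 =
    {ray_from z0 u | u. u ^ Suc s = sgn (f z0) \<or> u ^ Suc s = - sgn (f z0)}"
proof -
  have "incoming_separatrix_rays R z0 = {ray_from z0 u | u. u ^ Suc s = sgn (f z0)}"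
    unfolding incoming_separatrix_rays_def leading_term_at_pole_iff[OF assms]
      incoming_leading_direction_iff[OF assms(2), symmetric] by blast
  moreover have "outgoing_separatrix_rays R z0 = {ray_from z0 u | u. u ^ Suc s = - sgn (f z0)}"
    unfolding outgoing_separatrix_rays_def leading_term_at_pole_iff[OF assms]
      outgoing_leading_direction_iff[OF assms(2), symmetric] by blast
  ultimately show ?thesis by blast
qed

section \<open>Tangent rays of a curve on which \<open>h z / (z - z0) ^ n\<close> is real\<close>

text \<open>A holomorphic logarithm of \<open>h\<close> on the disc provides \<open>k\<close> with
  \<open>k ^ n = 1 / h\<close>, and \<open>\<phi> z = (z - z0) * k z\<close> has derivative
  \<open>k z0\<close>, which is nonzero, so it is locally invertible with inverse
  \<open>\<psi>\<close>.\<close>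

lemma holomorphic_power_coordinate:
  fixes h :: "complex \<Rightarrow> complex"
  assumes h: "h holomorphic_on ball z0 r" "\<And>z. z \<in> ball z0 r \<Longrightarrow> h z \<noteq> 0"
    and "r > 0" "n > 0"
  obtains U e \<phi> \<psi> where "open U" "z0 \<in> U" "U \<subseteq> ball z0 r" "e > 0"
    "continuous_on U \<phi>" "\<phi> ` U = ball 0 e" "\<phi> z0 = 0" "\<psi> holomorphic_on ball 0 e"
    "\<And>z. z \<in> U \<Longrightarrow> \<psi> (\<phi> z) = z" "\<And>z. z \<in> U \<Longrightarrow> \<phi> z ^ n * h z = (z - z0) ^ n"
    "deriv \<psi> 0 ^ n = h z0"
proof -
  obtain g where g: "g holomorphic_on ball z0 r" "\<And>z. z \<in> ball z0 r \<Longrightarrow> h z = exp (g z)"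
    using contractible_imp_holomorphic_log[OF h(1) convex_imp_contractible[OF convex_ball] h(2)] by metis
  define k where "k = (\<lambda>z. exp (- g z / of_nat n))"
  define \<phi> where "\<phi> = (\<lambda>z. (z - z0) * k z)"
  have k: "k holomorphic_on ball z0 r" unfolding k_def by (intro holomorphic_intros g) (use \<open>n > 0\<close> in auto)
  have kn: "k z ^ n * h z = 1" if "z \<in> ball z0 r" for z
  proof -
    have "k z ^ n = exp (of_nat n * (- g z / of_nat n))" by (simp only: k_def exp_of_nat_mult)
    also have "\<dots> = inverse (exp (g z))" using \<open>n > 0\<close> by (simp add: exp_minus)
    finally show ?thesis using g(2)[OF that] by simp
  qed
  have \<phi>: "\<phi> holomorphic_on ball z0 r" unfolding \<phi>_def by (intro holomorphic_intros k)
  have "(k has_field_derivative deriv k z0) (at z0)"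
    using k \<open>r > 0\<close> by (intro holomorphic_derivI[of k "ball z0 r"]) auto
  then have "(\<phi> has_field_derivative k z0) (at z0)"
    unfolding \<phi>_def by (auto intro!: derivative_eq_intros)
  then have d\<phi>: "deriv \<phi> z0 = k z0" by (rule DERIV_imp_deriv)
  have "deriv \<phi> z0 \<noteq> 0" unfolding d\<phi> by (simp add: k_def)
  then obtain q where q: "q > 0" "ball z0 q \<subseteq> ball z0 r" "open (\<phi> ` ball z0 q)" "inj_on \<phi> (ball z0 q)"
    using has_complex_derivative_locally_invertible[OF \<phi>, of z0] \<open>r > 0\<close> by auto
  have \<phi>q: "\<phi> holomorphic_on ball z0 q" using \<phi> q(2) by (rule holomorphic_on_subset)
  obtain \<psi> where \<psi>: "\<psi> holomorphic_on \<phi> ` ball z0 q"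
      "\<And>z. z \<in> ball z0 q \<Longrightarrow> deriv \<phi> z * deriv \<psi> (\<phi> z) = 1"
      "\<And>z. z \<in> ball z0 q \<Longrightarrow> \<psi> (\<phi> z) = z"
    using holomorphic_has_inverse[OF \<phi>q open_ball q(4)] by blast
  have \<phi>0: "\<phi> z0 = 0" by (simp add: \<phi>_def)
  then have "0 \<in> \<phi> ` ball z0 q" using q(1) by (metis centre_in_ball imageI)
  then obtain e where e: "e > 0" "ball 0 e \<subseteq> \<phi> ` ball z0 q" using q(3) openE by blast
  show thesis
  \<comment> \<open>The neighbourhood is cut down so that its image is a full disc: every segment
    through 0 in that disc can then be pulled back.\<close>
  proof (rule that[of "ball z0 q \<inter> \<phi> -` ball 0 e" e \<phi> \<psi>])
    have cont: "continuous_on (ball z0 q) \<phi>" using \<phi>q by (rule holomorphic_on_imp_continuous_on)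
    show "open (ball z0 q \<inter> \<phi> -` ball 0 e)"
      by (intro continuous_open_preimage cont) auto
    show "continuous_on (ball z0 q \<inter> \<phi> -` ball 0 e) \<phi>"
      using cont by (rule continuous_on_subset) auto
    show "\<psi> holomorphic_on ball 0 e" using \<psi>(1) e(2) by (rule holomorphic_on_subset)
    show "\<phi> ` (ball z0 q \<inter> \<phi> -` ball 0 e) = ball 0 e" using e(2) by blast
    have "k z0 * deriv \<psi> 0 = 1" using \<psi>(2)[of z0] q(1) by (simp add: \<phi>0 d\<phi>)
    then have "k z0 ^ n * deriv \<psi> 0 ^ n = 1" by (simp flip: power_mult_distrib)
    with kn[of z0] \<open>r > 0\<close> show "deriv \<psi> 0 ^ n = h z0"
      by (metis centre_in_ball mult.commute mult.right_neutral mult.assoc)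
    show "\<phi> z ^ n * h z = (z - z0) ^ n" if "z \<in> ball z0 q \<inter> \<phi> -` ball 0 e" for z
      using that q(2) kn[of z] by (auto simp: \<phi>_def power_mult_distrib mult.assoc)
  qed (use e q \<phi>0 \<psi>(3) in auto)
qed

text \<open>The quotient \<open>(w / c) ^ n\<close> is real and nonzero, so its sign is 1 or -1 and
  \<open>\<zeta> = sgn (w / c)\<close> is a 2n-th root of unity. Thus the points with real n-th
  power lie on finitely many lines through 0.\<close>

lemma real_power_imp_on_line:
  fixes w c :: complex
  assumes "w ^ n \<in> \<real>" "c ^ n \<in> \<real>" "c \<noteq> 0" "w \<noteq> 0"
  obtains \<zeta> where "\<zeta> ^ (2 * n) = 1" "w = of_real (norm (w / c)) * (\<zeta> * c)"
proof
  have "(w / c) ^ n \<in> \<real>" using assms by (simp add: power_divide)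
  then obtain x where x: "(w / c) ^ n = of_real x" by (elim Reals_cases)
  have "norm (w / c) ^ n = norm (complex_of_real x)" by (simp only: x flip: norm_power)
  then have nx: "norm (w / c) ^ n = \<bar>x\<bar>" by simp
  have "sgn (w / c) ^ n = sgn (of_real x)" by (simp only: x flip: sgn_power_complex)
  moreover have "x \<noteq> 0" using x assms by auto
  ultimately have "(sgn (w / c) ^ n)\<^sup>2 = 1"
    by (simp add: sgn_of_real) (simp add: sgn_if)
  then show "sgn (w / c) ^ (2 * n) = 1" by (simp add: mult.commute flip: power_mult)
  show "w = of_real (norm (w / c)) * (sgn (w / c) * c)"
    using assms by (simp add: sgn_eq)
qed

text \<open>In the coordinate \<open>\<phi>\<close> the punctured set is a union of finitely many
  lines through 0, and the branch is the preimage of the line through \<open>c\<close>. Relative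
  openness of the punctured branch follows by removing the other lines, which form a closed
  set.\<close>

lemma local_branch_line:
  fixes S :: "complex set"
  assumes U: "open U" "z0 \<in> U" and "e > 0" and \<phi>: "continuous_on U \<phi>" "\<phi> ` U = ball 0 e" "\<phi> z0 = 0"
    and \<psi>: "\<psi> holomorphic_on ball 0 e" "\<And>z. z \<in> U \<Longrightarrow> \<psi> (\<phi> z) = z"
    and S: "closed S" "\<And>z. z \<in> U - {z0} \<Longrightarrow> z \<in> S \<longleftrightarrow> \<phi> z ^ n \<in> \<real>"
    and c: "c \<noteq> 0" "c ^ n \<in> \<real>" and n: "n > 0"
  shows "local_branch S z0 (e / norm c) (\<lambda>t. \<psi> (of_real t * c))"
  unfolding local_branch_def
proof (intro conjI)
  let ?I = "{- (e / norm c)<..<e / norm c}" and ?\<gamma> = "\<lambda>t. \<psi> (of_real t * c)"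
  have ball: "of_real t * c \<in> ball 0 e" if "t \<in> ?I" for t
    using that c(1) by (auto simp: norm_mult abs_if field_simps split: if_splits)
  have \<gamma>: "?\<gamma> t \<in> U" "\<phi> (?\<gamma> t) = of_real t * c" if t: "t \<in> ?I" for t
  proof -
    obtain z where "z \<in> U" "of_real t * c = \<phi> z" using ball[OF t] \<phi>(2) by blast
    with \<psi>(2) show "?\<gamma> t \<in> U" "\<phi> (?\<gamma> t) = of_real t * c" by auto
  qed
  have \<gamma>0: "?\<gamma> 0 = z0" using \<psi>(2)[OF U(2)] \<phi>(3) by simp
  have \<gamma>nz: "?\<gamma> t \<noteq> z0" if t: "t \<in> ?I" "t \<noteq> 0" for t
    using \<gamma>(2)[OF t(1)] \<phi>(3) t(2) c(1) by auto
  have in_S: "?\<gamma> t \<in> S" if t: "t \<in> ?I" "t \<noteq> 0" for t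
    using S(2)[of "?\<gamma> t"] \<gamma>[OF t(1)] \<gamma>nz[OF t] c(2) by (auto simp: power_mult_distrib)
  show "0 < e / norm c" using c \<open>e > 0\<close> by simp
  have hol: "(\<lambda>z. \<psi> (z * c)) holomorphic_on ball 0 (e / norm c)"
  proof -
    have "(\<psi> \<circ> (\<lambda>z. z * c)) holomorphic_on ball 0 (e / norm c)"
      by (rule holomorphic_on_compose_gen[OF _ \<psi>(1)])
         (use c in \<open>auto intro!: holomorphic_intros simp: norm_mult field_simps\<close>)
    then show ?thesis by (simp add: o_def)
  qed
  then show "\<exists>g. g holomorphic_on ball 0 (e / norm c) \<and> (\<forall>t\<in>?I. ?\<gamma> t = g (of_real t))"
    by (intro exI[of _ "\<lambda>z. \<psi> (z * c)"]) auto
  show "inj_on ?\<gamma> ?I"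
  proof (rule inj_onI)
    fix x y assume "x \<in> ?I" "y \<in> ?I" "?\<gamma> x = ?\<gamma> y"
    then have "of_real x * c = of_real y * c" using \<gamma>(2) by metis
    then show "x = y" using c(1) by simp
  qed
  show "?\<gamma> 0 = z0" by (rule \<gamma>0)
  \<comment> \<open>The description of \<open>S\<close> by \<open>\<phi>\<close> omits
    \<open>z0\<close> itself; this point is reached as a limit of branch points, because
    \<open>S\<close> is closed.\<close>
  have "z0 \<in> S"
  proof (rule Lim_in_closed_set[OF S(1)])
    have "isCont (\<lambda>z. \<psi> (z * c)) 0"
      using holomorphic_on_imp_continuous_on[OF hol] \<open>0 < e / norm c\<close>
      by (simp add: continuous_on_eq_continuous_at)
    then have "((\<lambda>z. \<psi> (z * c)) \<longlongrightarrow> z0) (at 0)" using \<gamma>0 by (simp add: isCont_def)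
    moreover have "filterlim complex_of_real (at 0) (at 0)"
      by (intro filterlim_atI tendsto_eq_intros) (auto simp: eventually_neq_at_within)
    ultimately show "(?\<gamma> \<longlongrightarrow> z0) (at 0)" by (rule filterlim_compose)
    have "eventually (\<lambda>t. t \<in> ?I - {0}) (at 0)"
      using \<open>0 < e / norm c\<close> by (intro eventually_at_in_open) auto
    then show "eventually (\<lambda>t. ?\<gamma> t \<in> S) (at 0)" by eventually_elim (use in_S in auto)
  qed simp
  then show "?\<gamma> ` ?I \<subseteq> S" using in_S \<gamma>0 by (metis image_subsetI)
  \<comment> \<open>The roots 1 and -1 are left out because they give the line of \<open>c\<close>
    itself, so \<open>N\<close> collects the other lines. The point 0 is inserted by hand since
    \<open>Z\<close> is empty for \<open>n = 1\<close>.\<close>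
  define Z where "Z = {\<zeta>::complex. \<zeta> ^ (2 * n) = 1} - {1, - 1}"
  define N where "N = insert 0 (\<Union>\<zeta>\<in>Z. range (\<lambda>t. of_real t * (\<zeta> * c)))"
  have "finite Z" using finite_roots_unity[of "2 * n"] n unfolding Z_def by auto
  moreover have "closed (range (\<lambda>t. of_real t * b))" for b :: complex
  proof -
    have "range (\<lambda>t. of_real t * b) = span {b}" by (auto simp: span_singleton scaleR_conv_of_real)
    then show ?thesis by (metis closed_span)
  qed
  ultimately have "closed N" unfolding N_def by (intro closed_insert closed_UN) auto
  then have "open (U \<inter> \<phi> -` (- N))" by (intro continuous_open_preimage \<phi> U) auto
  moreover have "?\<gamma> ` (?I - {0}) = S \<inter> (U \<inter> \<phi> -` (- N))"
  proof (intro equalityI subsetI)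
    fix z assume "z \<in> ?\<gamma> ` (?I - {0})"
    then obtain t where t: "t \<in> ?I" "t \<noteq> 0" "z = ?\<gamma> t" by blast
    \<comment> \<open>A nonzero point common to the line of \<open>c\<close> and the line of
      \<open>\<zeta> * c\<close> makes \<open>\<zeta>\<close> real; a real root of unity is 1 or -1,
      and neither is in \<open>Z\<close>.\<close>
    have "of_real t * c \<notin> N"
    proof
      assume "of_real t * c \<in> N"
      moreover have "of_real t * c \<noteq> 0" using t(2) c(1) by simp
      ultimately obtain \<zeta> t' where *: "\<zeta> \<in> Z" "of_real t * c = of_real t' * (\<zeta> * c)"
        unfolding N_def by blast
      from *(2) have tt: "of_real t = of_real t' * \<zeta>" using c(1) by simp
      then have "t' \<noteq> 0" using t(2) by auto
      with tt have \<zeta>: "\<zeta> = of_real (t / t')" by (simp add: field_simps)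
      have "(t / t') ^ (2 * n) = 1"
        using *(1) unfolding Z_def \<zeta> by (simp only: of_real_power[symmetric] mem_Collect_eq Diff_iff of_real_eq_1_iff)
      then have "\<bar>t / t'\<bar> ^ (2 * n) = 1 ^ (2 * n)" by (metis dvd_triv_left power_even_abs power_one)
      then have "\<bar>t / t'\<bar> = 1" by (rule power_eq_imp_eq_base) (use n in auto)
      then have "t / t' = 1 \<or> t / t' = - 1" by arith
      then have "\<zeta> = 1 \<or> \<zeta> = - 1" unfolding \<zeta> by (metis of_real_1 of_real_minus)
      then show False using *(1) by (auto simp: Z_def)
    qed
    then show "z \<in> S \<inter> (U \<inter> \<phi> -` (- N))" using t \<gamma>[OF t(1)] in_S[OF t(1,2)] by auto
  next
    fix z assume z: "z \<in> S \<inter> (U \<inter> \<phi> -` (- N))"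
    then have "z \<noteq> z0" "\<phi> z \<noteq> 0" using \<phi>(3) by (auto simp: N_def)
    then have "\<phi> z ^ n \<in> \<real>" using S(2) z by auto
    then obtain \<zeta> where \<zeta>: "\<zeta> ^ (2 * n) = 1" "\<phi> z = of_real (norm (\<phi> z / c)) * (\<zeta> * c)"
      using real_power_imp_on_line c \<open>\<phi> z \<noteq> 0\<close> by metis
    have "\<zeta> \<notin> Z" using z \<zeta>(2) unfolding N_def by auto
    then have "\<zeta> = 1 \<or> \<zeta> = - 1" using \<zeta>(1) by (auto simp: Z_def)
    then obtain \<sigma> :: real where \<sigma>: "\<zeta> = of_real \<sigma>" "\<bar>\<sigma>\<bar> = 1"
      by (metis abs_minus abs_one of_real_1 of_real_minus)
    \<comment> \<open>The norm gives the size of the parameter, and the sign \<open>\<sigma>\<close>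
      tells on which half of the branch the point lies.\<close>
    define t where "t = norm (\<phi> z / c) * \<sigma>"
    have t: "\<phi> z = of_real t * c" unfolding t_def by (metis \<zeta>(2) \<sigma>(1) mult.assoc of_real_mult)
    have "norm (\<phi> z) < e" using z \<phi>(2) by fastforce
    then have "\<bar>t\<bar> < e / norm c" using c(1) by (simp add: t norm_mult field_simps)
    moreover have "t \<noteq> 0" using t \<open>\<phi> z \<noteq> 0\<close> by auto
    moreover have "z = ?\<gamma> t" using \<psi>(2)[of z] z t by auto
    ultimately show "z \<in> ?\<gamma> ` (?I - {0})" by (intro image_eqI[of _ _ t]) auto
  qed
  ultimately show "openin (top_of_set S) (?\<gamma> ` (?I - {0}))"
    by (auto simp: openin_open)
qed

text \<open>Division by a positive \<open>t\<close> leaves \<open>sgn\<close> unchanged, and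
  \<open>sgn\<close> is continuous at the nonzero derivative.\<close>

lemma tendsto_sgn_secant:
  fixes \<gamma> :: "real \<Rightarrow> complex"
  assumes "(\<gamma> has_vector_derivative d) (at 0)" "d \<noteq> 0"
  shows "((\<lambda>t. sgn (\<gamma> t - \<gamma> 0)) \<longlongrightarrow> sgn d) (at_right 0)"
proof -
  have "((\<lambda>t. (\<gamma> t - \<gamma> 0) /\<^sub>R t) \<longlongrightarrow> d) (at_right 0)"
  proof (rule LIM_zero_cancel)
    have "((\<lambda>t. (1 / \<bar>t\<bar>) *\<^sub>R (\<gamma> t - (\<gamma> 0 + t *\<^sub>R d))) \<longlongrightarrow> 0) (at_right 0)"
      using has_vector_derivative_at_within[OF assms(1), of "{0<..}"]
      by (simp add: has_vector_derivative_def has_derivative_within)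
    moreover have "\<forall>\<^sub>F t in at_right 0. (1 / \<bar>t\<bar>) *\<^sub>R (\<gamma> t - (\<gamma> 0 + t *\<^sub>R d)) = (\<gamma> t - \<gamma> 0) /\<^sub>R t - d"
      using eventually_at_right_less[of 0]
      by eventually_elim (simp add: scaleR_diff_right scaleR_add_right divide_inverse)
    ultimately show "((\<lambda>t. (\<gamma> t - \<gamma> 0) /\<^sub>R t - d) \<longlongrightarrow> 0) (at_right 0)"
      by (rule Lim_transform_eventually)
  qed
  from tendsto_sgn[OF this assms(2)] show ?thesis
  proof (rule Lim_transform_eventually)
    show "\<forall>\<^sub>F t in at_right 0. sgn ((\<gamma> t - \<gamma> 0) /\<^sub>R t) = sgn (\<gamma> t - \<gamma> 0)"
      using eventually_at_right_less[of 0] by eventually_elim (simp add: sgn_scaleR)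
  qed
qed

lemma tangent_rays_power_curve:
  assumes h: "h holomorphic_on ball z0 r" "\<And>z. z \<in> ball z0 r \<Longrightarrow> h z \<noteq> 0"
    and "r > 0" and n: "n > 0"
    and S: "closed S" "\<And>z. z \<in> ball z0 r - {z0} \<Longrightarrow> z \<in> S \<longleftrightarrow> h z / (z - z0) ^ n \<in> \<real>"
  shows "tangent_rays S z0 = {ray_from z0 u | u. u ^ n = sgn (h z0) \<or> u ^ n = - sgn (h z0)}"
proof -
  obtain U e \<phi> \<psi> where U: "open U" "z0 \<in> U" "U \<subseteq> ball z0 r" and "e > 0"
    and \<phi>: "continuous_on U \<phi>" "\<phi> ` U = ball 0 e" "\<phi> z0 = 0"
    and \<psi>: "\<psi> holomorphic_on ball 0 e" "\<And>z. z \<in> U \<Longrightarrow> \<psi> (\<phi> z) = z"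
    and \<phi>h: "\<And>z. z \<in> U \<Longrightarrow> \<phi> z ^ n * h z = (z - z0) ^ n" and d\<psi>: "deriv \<psi> 0 ^ n = h z0"
    using holomorphic_power_coordinate[OF h \<open>r > 0\<close> n] by metis
  have S': "z \<in> S \<longleftrightarrow> \<phi> z ^ n \<in> \<real>" if z: "z \<in> U - {z0}" for z
  proof -
    have "h z / (z - z0) ^ n = inverse (\<phi> z ^ n)"
      using z U(3) h(2)[of z] by (auto simp: field_simps simp flip: \<phi>h)
    then show ?thesis using S(2)[of z] z U(3) by (metis Diff_iff Reals_inverse inverse_inverse_eq subsetD)
  qed
  have h0: "h z0 \<noteq> 0" using h(2) \<open>r > 0\<close> by simp
  \<comment> \<open>Both halves of an arbitrary branch are treated at once, \<open>F\<close> being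
    either one-sided filter. No tangent vector is used, so \<open>\<gamma>\<close> may have
    derivative 0 at 0.\<close>
  have "u ^ n = sgn (h z0) \<or> u ^ n = - sgn (h z0)"
    if br: "local_branch S z0 \<epsilon> \<gamma>" and F: "F = at_right 0 \<or> F = at_left 0"
      and lim: "((\<lambda>t. sgn (\<gamma> t - z0)) \<longlongrightarrow> u) F" for u \<epsilon> \<gamma> and F :: "real filter"
  proof -
    have "\<epsilon> > 0" and \<gamma>: "inj_on \<gamma> {-\<epsilon><..<\<epsilon>}" "\<gamma> 0 = z0" "\<gamma> ` {-\<epsilon><..<\<epsilon>} \<subseteq> S"
      using br by (auto simp: local_branch_def)
    obtain g where g: "g holomorphic_on ball 0 \<epsilon>" "\<And>t. t \<in> {-\<epsilon><..<\<epsilon>} \<Longrightarrow> \<gamma> t = g (of_real t)"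
      using br by (auto simp: local_branch_def)
    have Fat: "F \<le> at 0" "F \<noteq> bot" using F by (elim disjE; simp add: at_le)+
    have evI: "\<forall>\<^sub>F t in at 0. t \<in> {-\<epsilon><..<\<epsilon>} - {0}"
      using \<open>\<epsilon> > 0\<close> by (intro eventually_at_in_open) auto
    have "isCont g 0"
      using holomorphic_on_imp_continuous_on[OF g(1)] \<open>\<epsilon> > 0\<close> by (simp add: continuous_on_eq_continuous_at)
    then have "(g \<longlongrightarrow> z0) (at 0)" using g(2)[of 0] \<gamma>(2) \<open>\<epsilon> > 0\<close> by (simp add: isCont_def)
    moreover have "filterlim complex_of_real (at 0) (at 0)"
      by (intro filterlim_atI tendsto_eq_intros) (auto simp: eventually_neq_at_within)
    ultimately have "((\<lambda>t. g (of_real t)) \<longlongrightarrow> z0) (at 0)" by (rule filterlim_compose)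
    moreover have "\<forall>\<^sub>F t in at 0. g (of_real t) = \<gamma> t"
      using evI by eventually_elim (use g(2) in auto)
    ultimately have "(\<gamma> \<longlongrightarrow> z0) (at 0)" by (rule Lim_transform_eventually)
    then have lim\<gamma>: "(\<gamma> \<longlongrightarrow> z0) F" by (rule tendsto_mono[OF Fat(1)])
    have "isCont h z0"
      using holomorphic_on_imp_continuous_on[OF h(1)] \<open>r > 0\<close> by (simp add: continuous_on_eq_continuous_at)
    then have "((\<lambda>t. h (\<gamma> t)) \<longlongrightarrow> h z0) F" using lim\<gamma> by (rule isCont_tendsto_compose)
    then have "((\<lambda>t. sgn (\<gamma> t - z0) ^ n / sgn (h (\<gamma> t))) \<longlongrightarrow> u ^ n / sgn (h z0)) F"
      by (intro tendsto_intros lim) (use h0 in \<open>auto simp: sgn_zero_iff\<close>)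
    \<comment> \<open>On the branch \<open>(\<gamma> t - z0) ^ n\<close> is a nonzero real multiple
      of \<open>h (\<gamma> t)\<close>, so this quotient of signs takes values in the closed set {1,
      -1}, and so does its limit.\<close>
    moreover have "\<forall>\<^sub>F t in F. sgn (\<gamma> t - z0) ^ n / sgn (h (\<gamma> t)) \<in> {1, - 1}"
      using filter_leD[OF Fat(1) evI] topological_tendstoD[OF lim\<gamma> U(1,2)]
    proof eventually_elim
      case (elim t)
      have "\<gamma> t \<noteq> \<gamma> 0" using inj_onD[OF \<gamma>(1), of t 0] elim(1) \<open>\<epsilon> > 0\<close> by auto
      then have ne: "\<gamma> t \<noteq> z0" using \<gamma>(2) by simp
      moreover have "\<gamma> t \<in> S" using elim(1) \<gamma>(3) by blast
      ultimately have "\<phi> (\<gamma> t) ^ n \<in> \<real>" using S'[of "\<gamma> t"] elim by simp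
      then obtain x where x: "\<phi> (\<gamma> t) ^ n = of_real x" by (elim Reals_cases)
      have eq: "of_real x * h (\<gamma> t) = (\<gamma> t - z0) ^ n" using \<phi>h[OF elim(2)] x by simp
      have hx: "h (\<gamma> t) \<noteq> 0" using h(2) elim(2) U(3) by blast
      have "x \<noteq> 0" using eq ne by auto
      have "sgn (\<gamma> t - z0) ^ n = sgn (of_real x) * sgn (h (\<gamma> t))"
        by (simp only: sgn_mult flip: eq sgn_power_complex)
      with hx have "sgn (\<gamma> t - z0) ^ n / sgn (h (\<gamma> t)) = of_real (sgn x)"
        by (simp add: sgn_zero_iff sgn_of_real)
      with \<open>x \<noteq> 0\<close> show ?case by (auto simp: sgn_if)
    qed
    ultimately have "u ^ n / sgn (h z0) \<in> {1, - 1}"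
      by (intro Lim_in_closed_set[OF _ _ Fat(2)]) auto
    then show ?thesis using h0 by (auto simp: divide_eq_eq sgn_zero_iff)
  qed
  moreover have "\<exists>e \<gamma>. local_branch S z0 e \<gamma> \<and> ((\<lambda>t. sgn (\<gamma> t - z0)) \<longlongrightarrow> u) (at_right 0)"
    if u: "u ^ n = sgn (h z0) \<or> u ^ n = - sgn (h z0)" for u
  proof -
    have d0: "deriv \<psi> 0 \<noteq> 0" using d\<psi> h0 n by (metis power_0_left less_not_refl)
    \<comment> \<open>The branch along \<open>c\<close> has velocity
      \<open>c * deriv \<psi> 0\<close> at 0, which is to equal \<open>u\<close>. Since
      \<open>deriv \<psi> 0 ^ n = h z0\<close>, the condition on \<open>u\<close> says that
      \<open>c ^ n\<close> is real. Each \<open>u\<close> gets its own \<open>c\<close>, so right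
      halves suffice.\<close>
    define c where "c = u / deriv \<psi> 0"
    have "norm u ^ n = norm (u ^ n)" by (simp only: norm_power)
    also have "\<dots> = 1" using u h0 by (auto simp: norm_sgn)
    finally have nu: "norm u = 1" using n power_eq_imp_eq_base[of "norm u" n 1] by simp
    have "sgn (h z0) / h z0 = of_real (inverse (norm (h z0)))"
      using h0 by (simp add: sgn_eq field_simps)
    then have "sgn (h z0) / h z0 \<in> \<real>" by (metis Reals_of_real)
    then have "c ^ n \<in> \<real>"
      using u by (auto simp: c_def power_divide d\<psi>)
    moreover have "c \<noteq> 0" using nu d0 by (auto simp: c_def)
    ultimately have br: "local_branch S z0 (e / norm c) (\<lambda>t. \<psi> (of_real t * c))"
      using local_branch_line[OF U(1,2) \<open>e > 0\<close> \<phi> \<psi> S(1) S' _ _ n] by blast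
    have \<psi>0: "\<psi> 0 = z0" using \<psi>(2)[OF U(2)] \<phi>(3) by simp
    have "((\<lambda>t. of_real t * c) has_vector_derivative 1 * c) (at 0)"
      using has_vector_derivative_mult_left[OF has_vector_derivative_of_real[OF DERIV_ident]] by simp
    moreover have "(\<psi> has_field_derivative deriv \<psi> 0) (at (of_real 0 * c))"
      using holomorphic_derivI[OF \<psi>(1) open_ball, of 0] \<open>e > 0\<close> by simp
    ultimately have "((\<psi> \<circ> (\<lambda>t. of_real t * c)) has_vector_derivative 1 * c * deriv \<psi> 0) (at 0)"
      by (rule field_vector_diff_chain_at)
    then have "((\<lambda>t. \<psi> (of_real t * c)) has_vector_derivative u) (at 0)"
      using d0 by (simp add: o_def c_def)
    moreover have "u \<noteq> 0" "sgn u = u" using nu by (auto simp: sgn_eq)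
    ultimately have "((\<lambda>t. sgn (\<psi> (of_real t * c) - z0)) \<longlongrightarrow> u) (at_right 0)"
      using tendsto_sgn_secant[of "\<lambda>t. \<psi> (of_real t * c)" u] \<psi>0 by simp
    with br show ?thesis by blast
  qed
  ultimately show ?thesis unfolding tangent_rays_def by blast
qed

section \<open>The inflection curve near a pole\<close>

lemma deriv_pole_quotient:
  assumes f: "f holomorphic_on ball z0 r" and z: "z \<in> ball z0 r - {z0}"
    and R: "\<And>z. z \<in> ball z0 r - {z0} \<Longrightarrow> R z = f z / (z - z0) ^ s"
  shows "deriv R z = (deriv f z * (z - z0) - of_nat s * f z) / (z - z0) ^ Suc s"
proof -
  \<comment> \<open>The case split on \<open>s\<close> deals with the truncated exponent
    \<open>s - 1\<close> at \<open>s = 0\<close>, where the factor \<open>of_nat s\<close>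
    vanishes.\<close>
  have quot: "(A * d ^ s - B * (of_nat s * d ^ (s - 1))) / (d ^ s * d ^ s) = (A * d - of_nat s * B) / d ^ Suc s"
    if "d \<noteq> 0" for A B d :: complex
    using that by (cases s) (auto simp: field_simps)
  have "(f has_field_derivative deriv f z) (at z)"
    using f z by (intro holomorphic_derivI[of f "ball z0 r"]) auto
  then have "((\<lambda>z. f z / (z - z0) ^ s) has_field_derivative
      (deriv f z * (z - z0) ^ s - f z * (of_nat s * (z - z0) ^ (s - 1))) / ((z - z0) ^ s * (z - z0) ^ s)) (at z)"
    using z by (auto intro!: derivative_eq_intros)
  also have "(deriv f z * (z - z0) ^ s - f z * (of_nat s * (z - z0) ^ (s - 1))) / ((z - z0) ^ s * (z - z0) ^ s) =
      (deriv f z * (z - z0) - of_nat s * f z) / (z - z0) ^ Suc s"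
    by (rule quot) (use z in simp)
  finally have "(R has_field_derivative (deriv f z * (z - z0) - of_nat s * f z) / (z - z0) ^ Suc s) (at z)"
    by (rule has_field_derivative_transform_within_open[of _ _ _ "ball z0 r - {z0}"]) (use R z in auto)
  then show ?thesis by (rule DERIV_imp_deriv)
qed

text \<open>A zero set of a continuous function is relatively closed in the open set
  \<open>V\<close>, so taking the closure adds no points there. This removes the closure from
  \<open>inflection_curve\<close> away from the pole.\<close>

lemma closure_zero_set_iff:
  fixes g :: "'a :: topological_space \<Rightarrow> real"
  assumes "open V" "continuous_on V g" "z \<in> V" "\<And>z. z \<in> V \<Longrightarrow> z \<in> A \<longleftrightarrow> g z = 0"
  shows "z \<in> closure A \<longleftrightarrow> g z = 0"
proof
  have "open (V \<inter> g -` (- {0}))" using assms(1,2) by (intro continuous_open_preimage) auto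
  moreover have "(V \<inter> g -` (- {0})) \<inter> A = {}" using assms(4) by auto
  ultimately have "(V \<inter> g -` (- {0})) \<inter> closure A = {}" by (simp add: open_Int_closure_eq_empty)
  then show "z \<in> closure A \<Longrightarrow> g z = 0" using assms(3) by auto
qed (use assms closure_subset in auto)

lemma inflection_curve_near_pole:
  assumes f: "f holomorphic_on ball z0 r" "\<And>z. z \<in> ball z0 r \<Longrightarrow> f z \<noteq> 0"
    and P: "\<And>z. z \<in> ball z0 r - {z0} \<Longrightarrow> poly P z \<noteq> 0"
    and R: "\<And>z. z \<in> ball z0 r - {z0} \<Longrightarrow> rational_fun Q P z = f z / (z - z0) ^ s"
    and z: "z \<in> ball z0 r - {z0}"
  shows "z \<in> inflection_curve Q P \<longleftrightarrow>
    (deriv f z * (z - z0) - of_nat s * f z) / (z - z0) ^ Suc s \<in> \<real>"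
  unfolding inflection_curve_def complex_is_Real_iff
proof (rule closure_zero_set_iff[OF _ _ z])
  show "open (ball z0 r - {z0})" by auto
  have "(\<lambda>z. (deriv f z * (z - z0) - of_nat s * f z) / (z - z0) ^ Suc s) holomorphic_on ball z0 r - {z0}"
    by (intro holomorphic_intros holomorphic_on_subset[OF f(1)] holomorphic_on_subset[OF holomorphic_deriv[OF f(1)]])
       auto
  then show "continuous_on (ball z0 r - {z0}) (\<lambda>z. Im ((deriv f z * (z - z0) - of_nat s * f z) / (z - z0) ^ Suc s))"
    by (intro continuous_intros holomorphic_on_imp_continuous_on)
  fix z assume z: "z \<in> ball z0 r - {z0}"
  then have "rational_fun Q P z \<noteq> 0" using R[OF z] f(2) by auto
  then show "z \<in> {z. rational_fun Q P z \<noteq> 0 \<and> poly P z \<noteq> 0 \<and> Im (deriv (rational_fun Q P) z) = 0} \<longleftrightarrow>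
      Im ((deriv f z * (z - z0) - of_nat s * f z) / (z - z0) ^ Suc s) = 0"
    using P[OF z] by (simp only: deriv_pole_quotient[OF f(1) z R] mem_Collect_eq simp_thms)
qed

theorem proposition6p1:
  fixes P Q :: "complex poly" and z0 :: complex and s :: nat
  assumes "P \<noteq> 0"
    and "coprime P Q"
    and "\<not> rational_fun Q P constant_on {z. poly P z \<noteq> 0}"
    and "s \<ge> 1"
    and "is_pole (rational_fun Q P) z0"
    and "zorder (rational_fun Q P) z0 = - int s"
  shows "tangent_rays (inflection_curve Q P) z0 =
         incoming_separatrix_rays (rational_fun Q P) z0 \<union>
         outgoing_separatrix_rays (rational_fun Q P) z0"
proof -
  \<comment> \<open>Only the other zeros of \<open>P\<close> are removed, so \<open>S\<close> is an
    open set containing the pole on which it is the only singularity.\<close>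
  define S where "S = - ({z. poly P z = 0} - {z0})"
  have "open S" unfolding S_def
    using poly_roots_finite[OF \<open>P \<noteq> 0\<close>] by (intro open_Compl finite_imp_closed) auto
  have "z0 \<in> S" by (simp add: S_def)
  have holo: "rational_fun Q P holomorphic_on S - {z0}"
    unfolding rational_fun_def by (intro holomorphic_intros) (auto simp: S_def)
  define f where "f = zor_poly (rational_fun Q P) z0"
  obtain r1 where r1: "f z0 \<noteq> 0" "r1 > 0" "cball z0 r1 \<subseteq> S" "f holomorphic_on cball z0 r1"
    "\<And>z. z \<in> cball z0 r1 - {z0} \<Longrightarrow> rational_fun Q P z = f z / (z - z0) ^ s \<and> f z \<noteq> 0"
    using zorder_exist_pole[OF holo \<open>open S\<close> \<open>z0 \<in> S\<close> assms(5)] unfolding assms(6) f_def[symmetric]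
    by auto
  have f1: "f holomorphic_on ball z0 r1" using r1(4) by (rule holomorphic_on_subset) auto
  \<comment> \<open>\<open>h\<close> is the numerator of the derivative of the rational function
    over \<open>(z - z0) ^ Suc s\<close>; at \<open>z0\<close> only the term with \<open>f\<close>
    survives.\<close>
  define h where "h = (\<lambda>z. deriv f z * (z - z0) - of_nat s * f z)"
  have h1: "h holomorphic_on ball z0 r1"
    unfolding h_def by (intro holomorphic_intros f1 holomorphic_deriv open_ball)
  have hz0: "h z0 = - of_nat s * f z0" by (simp add: h_def)
  then have "h z0 \<noteq> 0" using r1(1) \<open>s \<ge> 1\<close> by simp
  moreover have "isCont h z0"
    using holomorphic_on_imp_continuous_on[OF h1] r1(2) by (simp add: continuous_on_eq_continuous_at)
  ultimately obtain r2 where r2: "r2 > 0" "\<And>z. z \<in> ball z0 r2 \<Longrightarrow> h z \<noteq> 0"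
    using continuous_at_avoid[of z0 h 0] by (auto simp: dist_commute)
  define r where "r = min r1 r2"
  have r: "r > 0" "ball z0 r \<subseteq> ball z0 r1" "ball z0 r \<subseteq> ball z0 r2" using r1(2) r2(1) by (auto simp: r_def)
  have fr: "f holomorphic_on ball z0 r" using f1 r(2) by (rule holomorphic_on_subset)
  have fnz: "f z \<noteq> 0" if "z \<in> ball z0 r" for z
    using r1(1) r1(5)[of z] that r(2) ball_subset_cball[of z0 r1] by (cases "z = z0") auto
  have P: "poly P z \<noteq> 0" if "z \<in> ball z0 r - {z0}" for z
  proof -
    have "z \<in> S" using that r(2) r1(3) ball_subset_cball[of z0 r1] by blast
    then show ?thesis using that by (simp add: S_def)
  qed
  have R: "rational_fun Q P z = f z / (z - z0) ^ s" if "z \<in> ball z0 r - {z0}" for z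
    using r1(5)[of z] that r(2) ball_subset_cball[of z0 r1] by auto
  \<comment> \<open>Differentiation flips the sign of the leading coefficient. This only exchanges
    the two alternatives for \<open>u ^ Suc s\<close>, so the two sets of rays agree as
    unions.\<close>
  have "sgn (h z0) = - sgn (f z0)"
    using \<open>s \<ge> 1\<close> by (simp add: hz0 sgn_mult sgn_minus) (simp add: sgn_eq)
  moreover have "tangent_rays (inflection_curve Q P) z0 =
      {ray_from z0 u | u. u ^ Suc s = sgn (h z0) \<or> u ^ Suc s = - sgn (h z0)}"
  proof (rule tangent_rays_power_curve[of h z0 r])
    show "closed (inflection_curve Q P)" by (simp add: inflection_curve_def)
    show "z \<in> inflection_curve Q P \<longleftrightarrow> h z / (z - z0) ^ Suc s \<in> \<real>" if "z \<in> ball z0 r - {z0}" for z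
      unfolding h_def by (rule inflection_curve_near_pole[OF fr fnz P R that])
  qed (use r r2 holomorphic_on_subset[OF h1 r(2)] in auto)
  moreover have "incoming_separatrix_rays (rational_fun Q P) z0 \<union>
      outgoing_separatrix_rays (rational_fun Q P) z0 =
      {ray_from z0 u | u. u ^ Suc s = sgn (f z0) \<or> u ^ Suc s = - sgn (f z0)}"
  proof (rule separatrix_rays_eq)
    show "f field_differentiable at z0"
      using fr r(1) by (intro holomorphic_on_imp_differentiable_at[of f "ball z0 r"]) auto
    have "\<forall>\<^sub>F z in at z0. z \<in> ball z0 r - {z0}" using r(1) by (intro eventually_at_in_open) auto
    then show "\<forall>\<^sub>F z in at z0. rational_fun Q P z = f z / (z - z0) ^ s"
      by eventually_elim (rule R)
  qed (use r1(1) \<open>s \<ge> 1\<close> in auto)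
  ultimately show ?thesis by auto
qed

end
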